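(* Let $F:\mathbb{R}^{n_0}\to\mathbb{R}$ be a ReLU neural network of architecture $(n_0,\dots,n_m;1)$. If $F$ is transversal, then the bent hyperplane arrangement $\mathcal{B}_F$ is the domain (underlying set) of the $(n_0-1)$-skeleton of the canonical polyhedral complex $\mathcal{C}(F)$, and the closures of the activation regions of $F$ are the $n_0$-cells of $\mathcal{C}(F)$.
   Context: **ReLU networks.** $\mathrm{ReLU}(x)=\max\{0,x\}$, and $\sigma:\mathbb{R}^n\to\mathbb{R}^n$ applies ReLU to each coordinate. A ReLU neural network of architecture $(n_0,\dots,n_m;1)$ (positive integers $n_0,\ldots,n_m$, $n_{m+1}=1$) is a sequence of affine maps $A_i:\mathbb{R}^{n_{i-1}}\to\mathbb{R}^{n_i}$, $i=1,\dots,m+1$; its layer maps are $F_i=\sigma\circ A_i$ for $i\le m$ and $G=A_{m+1}$, and the network map is $F=G\circ F_m\circ\cdots\circ F_1$. **Hyperplane arrangement of a layer.** Write $A_i(x)=Wx+b$. The $j$-th row gives the set $S_j=\{x: W_j\cdot x+b_j=0\}$. It is degenerate if $W_j=0$, and otherwise it is an affine hyperplane. The hyperplane arrangement $\mathcal{A}^{(i)}$ in $\mathbb{R}^{n_{i-1}}$ associated to $F_i$ is the finite set of the nondegenerate $S_j$. **Polyhedral complexes.** A polyhedral set is a finite intersection of closed affine half-spaces; its dimension is that of its affine hull. Its faces are $\emptyset$, itself, and its intersections with supporting hyperplanes. A polyhedral complex is a finite set of polyhedral sets (cells) closed under taking faces and such that any two cells intersect in a common face. Its domain is the union of its cells. Its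 $k$-skeleton is the subcomplex of cells of dimension $\le k$. A hyperplane arrangement $\mathcal{A}$ in $\mathbb{R}^n$ induces the polyhedral complex $\mathcal{C}(\mathcal{A})$ with domain $\mathbb{R}^n$ whose $n$-cells are the closures of the connected components of $\mathbb{R}^n\setminus\bigcup_{H\in\mathcal{A}}H$ and whose other cells are the faces of these. **Canonical complex.** Let $R^{(i)}=\mathcal{C}(\mathcal{A}^{(i)})$. Set $\mathcal{C}(F_1):=R^{(1)}$ and, for $i=2,\dots,m$, let $\mathcal{C}(F_i\circ\cdots\circ F_1)$ be the polyhedral complex $\{S\cap (F_{i-1}\circ\cdots\circ F_1)^{-1}(Y): S\in\mathcal{C}(F_{i-1}\circ\cdots\circ F_1),\ Y\in R^{(i)}\}$. The canonical polyhedral complex of $F$ is $\mathcal{C}(F):=\mathcal{C}(F_m\circ\cdots\circ F_1)$. It has domain $\mathbb{R}^{n_0}$ and $F$ is affine-linear on each of its cells. For a network with no hidden layers (an affine map $\mathbb{R}^{n_0}\to\mathbb{R}$) the canonical complex is the trivial decomposition with single nonempty cell $\mathbb{R}^{n_0}$. **Bent hyperplanes and activation regions.** $\mathcal{B}_F^{(1)}=\bigcup_{H\in\mathcal{A}^{(1)}}H$; for $2\le k\le m$, $\mathcal{B}_F^{(k)}=\bigcup_{H\in\mathcal{A}^{(k)}}(F_{k-1}\circ\cdots\circ F_1)^{-1}(H)$; and $\mathcal{B}_F=\bigcup_{k=1}^m\mathcal{B}_F^{(k)}$ is the bent hyperplane arrangement. An activation region of $F$ is a connected component of $\mathbb{R}^{n_0}\setminus\mathcal{B}_F$.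 **Transversality.** For a polyhedral complex $M$ in $\mathbb{R}^{n_0}$ and $f:|M|\to\mathbb{R}$ affine-linear on cells, $t\in\mathbb{R}$ is a transversal threshold for $f$ and $M$ if for every cell $C$ of dimension $\ge1$ the restriction of $f$ to the relative interior $\mathrm{int}(C)$ is transverse to $\{t\}$ (its differential is surjective at every point of $\mathrm{int}(C)\cap f^{-1}(t)$), and $f(v)\neq t$ for every $0$-cell $v$. A threshold is transversal for a network if it is so for the network map and its canonical complex. For $i\in\{1,\dots,m\}$, $j\in\{1,\dots,n_i\}$ the node map is $F_{i,j}=\pi_j\circ A_i\circ F_{i-1}\circ\cdots\circ F_1:\mathbb{R}^{n_0}\to\mathbb{R}$ ($\pi_j$ the $j$-th coordinate projection), which is itself a ReLU network of architecture $(n_0,\dots,n_{i-1};1)$. $F$ is transversal if $t=0$ is a transversal threshold for every node map $F_{i,j}$, $1\le i\le m$, $1\le j\le n_i$. *)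

theory Defs
  imports "HOL-Analysis.Analysis"
begin

section \<open>Euclidean spaces of varying dimension\<close>

text \<open>
  A network passes through spaces of different dimensions \<open>n\<^sub>0, \<dots>, n\<^sub>m, 1\<close>.  All of them
  are realised inside one space \<open>real ^ 'k\<close>: the space with coordinates indexed by a set
  \<open>J :: 'k set\<close> of cardinality \<open>n\<close> is the coordinate subspace below, an isometric copy of
  \<open>n\<close>-dimensional Euclidean space.  As \<open>'k\<close> is an arbitrary finite type, any finite list of
  dimensions can occur.  Affine dimension, closure, connected components, relative interior
  and faces of subsets of a coordinate subspace do not depend on the ambient space.
\<close>

definition coord_space :: "'k set \<Rightarrow> (real ^ 'k::finite) set" where
  "coord_space J = {x. \<forall>j. j \<notin> J \<longrightarrow> x $ j = 0}"


section \<open>ReLU networks\<close>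

text \<open>
  \<open>units N i\<close> indexes the coordinates of layer \<open>i\<close>, where layer \<open>0\<close> is the input and layer
  \<open>hidden_layers N + 1\<close> is the output.  The affine map of layer \<open>i \<ge> 1\<close> is given by the matrix
  \<open>weight N i\<close> and the vector \<open>bias N i\<close>.
\<close>

record 'k relu_network =
  hidden_layers :: nat
  units :: "nat \<Rightarrow> 'k set"
  weight :: "nat \<Rightarrow> real ^ 'k ^ 'k"
  bias :: "nat \<Rightarrow> real ^ 'k"

text \<open>
  Architecture \<open>(n\<^sub>0, \<dots>, n\<^sub>m; 1)\<close>.  The support conditions on weights and biases say that the
  \<open>i\<close>-th affine map has no entries besides those of an \<open>n\<^sub>i \<times> n\<^bsub>i-1\<^esub>\<close> matrix and a vector of
  length \<open>n\<^sub>i\<close>; so a row of the matrix vanishes iff it vanishes as a vector of length \<open>n\<^bsub>i-1\<^esub>\<close>.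
\<close>

definition has_architecture ::
    "'k::finite relu_network \<Rightarrow> nat \<Rightarrow> (nat \<Rightarrow> nat) \<Rightarrow> bool" where
  "has_architecture N m n \<longleftrightarrow>
     hidden_layers N = m \<and>
     (\<forall>i\<le>m. 0 < n i) \<and> n (m + 1) = 1 \<and>
     (\<forall>i\<le>m + 1. card (units N i) = n i) \<and>
     (\<forall>i\<in>{1..m + 1}. \<forall>j l. weight N i $ j $ l \<noteq> 0 \<longrightarrow> j \<in> units N i \<and> l \<in> units N (i - 1)) \<and>
     (\<forall>i\<in>{1..m + 1}. \<forall>j. bias N i $ j \<noteq> 0 \<longrightarrow> j \<in> units N i)"

definition layer_space :: "'k::finite relu_network \<Rightarrow> nat \<Rightarrow> (real ^ 'k) set" where
  "layer_space N i = coord_space (units N i)"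

definition affine_layer :: "'k::finite relu_network \<Rightarrow> nat \<Rightarrow> real ^ 'k \<Rightarrow> real ^ 'k" where
  "affine_layer N i x = weight N i *v x + bias N i"

definition relu :: "real ^ 'k \<Rightarrow> real ^ 'k::finite" where
  "relu x = (\<chi> j. max 0 (x $ j))"

definition layer_map :: "'k::finite relu_network \<Rightarrow> nat \<Rightarrow> real ^ 'k \<Rightarrow> real ^ 'k" where
  "layer_map N i = relu \<circ> affine_layer N i"

text \<open>\<open>hidden_map N i\<close> is the composition of the layer maps \<open>1, \<dots>, i\<close>.\<close>

primrec hidden_map :: "'k::finite relu_network \<Rightarrow> nat \<Rightarrow> real ^ 'k \<Rightarrow> real ^ 'k" where
  "hidden_map N 0 = id"
| "hidden_map N (Suc i) = layer_map N (Suc i) \<circ> hidden_map N i"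

definition node_map :: "'k::finite relu_network \<Rightarrow> nat \<Rightarrow> 'k \<Rightarrow> real ^ 'k \<Rightarrow> real" where
  "node_map N i j x = affine_layer N i (hidden_map N (i - 1) x) $ j"

text \<open>The map computed by the network; the output layer has a single unit.\<close>

definition network_map :: "'k::finite relu_network \<Rightarrow> real ^ 'k \<Rightarrow> real" where
  "network_map N =
     node_map N (hidden_layers N + 1) (the_elem (units N (hidden_layers N + 1)))"


section \<open>Hyperplane arrangements and polyhedral complexes\<close>

text \<open>The \<open>i\<close>-th arrangement lives in layer space \<open>i - 1\<close>; zero rows are the degenerate ones.\<close>

definition layer_arrangement :: "'k::finite relu_network \<Rightarrow> nat \<Rightarrow> (real ^ 'k) set set" where
  "layer_arrangement N i =
     {{x \<in> layer_space N (i - 1). weight N i $ j \<bullet> x + bias N i $ j = 0} | j.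
        j \<in> units N i \<and> weight N i $ j \<noteq> 0}"

text \<open>
  The complex induced by an arrangement \<open>\<A>\<close> in the space \<open>V\<close>.  Since the normal vector in
  \<open>exposed_face_of\<close> may be zero, the exposed faces of a convex set are the empty set, the
  set itself, and its intersections with supporting hyperplanes.
\<close>

definition arrangement_complex ::
    "'a::euclidean_space set \<Rightarrow> 'a set set \<Rightarrow> 'a set set" where
  "arrangement_complex V \<A> =
     {T. \<exists>C \<in> components (V - \<Union>\<A>). T exposed_face_of closure C}"

definition skeleton :: "int \<Rightarrow> 'a::euclidean_space set set \<Rightarrow> 'a set set" where
  "skeleton k M = {C \<in> M. aff_dim C \<le> k}"

definition layer_complex :: "'k::finite relu_network \<Rightarrow> nat \<Rightarrow> (real ^ 'k) set set" where
  "layer_complex N i = arrangement_complex (layer_space N (i - 1)) (layer_arrangement N i)"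

text \<open>
  The canonical complex of the first \<open>i\<close> layer maps; for \<open>i = 0\<close> it is the trivial
  decomposition of the input space, whose cells are that space and its empty face.
\<close>

fun canonical_complex_upto :: "'k::finite relu_network \<Rightarrow> nat \<Rightarrow> (real ^ 'k) set set" where
  "canonical_complex_upto N 0 = {{}, layer_space N 0}"
| "canonical_complex_upto N (Suc 0) = layer_complex N 1"
| "canonical_complex_upto N (Suc (Suc i)) =
     {S \<inter> {x \<in> layer_space N 0. hidden_map N (Suc i) x \<in> Y} | S Y.
        S \<in> canonical_complex_upto N (Suc i) \<and> Y \<in> layer_complex N (Suc (Suc i))}"

definition canonical_complex :: "'k::finite relu_network \<Rightarrow> (real ^ 'k) set set" where
  "canonical_complex N = canonical_complex_upto N (hidden_layers N)"


section \<open>Bent hyperplanes and activation regions\<close>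

text \<open>For \<open>k = 1\<close> the preimage is taken under the identity.\<close>

definition bent_layer :: "'k::finite relu_network \<Rightarrow> nat \<Rightarrow> (real ^ 'k) set" where
  "bent_layer N k =
     (\<Union>H \<in> layer_arrangement N k. {x \<in> layer_space N 0. hidden_map N (k - 1) x \<in> H})"

definition bent_arrangement :: "'k::finite relu_network \<Rightarrow> (real ^ 'k) set" where
  "bent_arrangement N = (\<Union>k \<in> {1..hidden_layers N}. bent_layer N k)"

definition activation_regions :: "'k::finite relu_network \<Rightarrow> (real ^ 'k) set set" where
  "activation_regions N = components (layer_space N 0 - bent_arrangement N)"


section \<open>Transversality\<close>

text \<open>
  The tangent space of the relative interior of a cell \<open>C\<close> at \<open>x\<close> consists of the differences
  \<open>y - x\<close> with \<open>y\<close> in the affine hull of \<open>C\<close>; on this space the derivative within the relative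
  interior is uniquely determined.
\<close>

definition transversal_on_cell ::
    "('a::euclidean_space \<Rightarrow> real) \<Rightarrow> 'a set \<Rightarrow> real \<Rightarrow> bool" where
  "transversal_on_cell f C t \<longleftrightarrow>
     (\<forall>x \<in> rel_interior C. f x = t \<longrightarrow>
        (\<exists>D. (f has_derivative D) (at x within rel_interior C) \<and>
             D ` {y - x | y. y \<in> affine hull C} = UNIV))"

definition transversal_threshold ::
    "('a::euclidean_space \<Rightarrow> real) \<Rightarrow> 'a set set \<Rightarrow> real \<Rightarrow> bool" where
  "transversal_threshold f M t \<longleftrightarrow>
     (\<forall>C \<in> M. 1 \<le> aff_dim C \<longrightarrow> transversal_on_cell f C t) \<and>
     (\<forall>v. {v} \<in> M \<longrightarrow> f v \<noteq> t)"

text \<open>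
  The node map at layer \<open>i\<close> is a network whose hidden layers are the first \<open>i - 1\<close> layers of
  \<open>N\<close>; hence its canonical complex is \<open>canonical_complex_upto N (i - 1)\<close>.
\<close>

definition transversal_network :: "'k::finite relu_network \<Rightarrow> bool" where
  "transversal_network N \<longleftrightarrow>
     (\<forall>i \<in> {1..hidden_layers N}. \<forall>j \<in> units N i.
        transversal_threshold (node_map N i j) (canonical_complex_upto N (i - 1)) 0)"

end

theory Submission
  imports Defs
begin

text \<open>
  Without any transversality, the nonempty cells of the canonical complex are exactly the sets
  \<open>Q x\<close> of those \<open>y\<close> at which every node map vanishes or has the same sign as at \<open>x\<close>: on such a
  set all node maps are affine, so a cell equals \<open>Q w\<close> for each \<open>w\<close> in its relative interior.
  If no node map vanishes at \<open>x\<close>, then \<open>Q x\<close> is the closure of the convex, relatively open set of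
  points with the signs of \<open>x\<close>, and these sets are the components of the complement of the zero
  sets of the node maps.  Transversality says that no node map vanishes identically on a cell of
  the preceding complex.  Hence zero rows contribute no zeros, and if some node map vanishes at
  \<open>x\<close>, it vanishes on \<open>Q x\<close>, which then is not full-dimensional.
\<close>

section \<open>Cells given by sign vectors\<close>

text \<open>A polyhedron written by weak sign conditions: \<open>s a\<close> equal to 1 or -1 gives
  a half-space condition and \<open>s a = 0\<close> an equation, as soon as \<open>f a\<close> is
  affine on a suitable set. The two cases need no separate treatment later.\<close>

definition closed_cell :: "'a set \<Rightarrow> 'b set \<Rightarrow> ('b \<Rightarrow> 'a \<Rightarrow> real) \<Rightarrow> ('b \<Rightarrow> real) \<Rightarrow> 'a set" where
  "closed_cell V I f s = {y \<in> V. \<forall>a\<in>I. sgn (f a y) \<in> {0, s a}}"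

definition open_cell :: "'a set \<Rightarrow> 'b set \<Rightarrow> ('b \<Rightarrow> 'a \<Rightarrow> real) \<Rightarrow> ('b \<Rightarrow> real) \<Rightarrow> 'a set" where
  "open_cell V I f s = {y \<in> V. \<forall>a\<in>I. sgn (f a y) = s a}"

text \<open>Only convex combinations are tested, since node maps are affine merely on convex cells
  and not on their affine hulls.\<close>

definition affine_fun_on :: "'a::real_vector set \<Rightarrow> ('a \<Rightarrow> 'b::real_vector) \<Rightarrow> bool" where
  "affine_fun_on S f \<longleftrightarrow> (\<forall>x\<in>S. \<forall>y\<in>S. \<forall>u v. 0 \<le> u \<longrightarrow> 0 \<le> v \<longrightarrow> u + v = 1 \<longrightarrow>
     f (u *\<^sub>R x + v *\<^sub>R y) = u *\<^sub>R f x + v *\<^sub>R f y)"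

lemma affine_fun_onD:
  "affine_fun_on S f \<Longrightarrow> x \<in> S \<Longrightarrow> y \<in> S \<Longrightarrow> 0 \<le> u \<Longrightarrow> 0 \<le> v \<Longrightarrow> u + v = 1 \<Longrightarrow>
    f (u *\<^sub>R x + v *\<^sub>R y) = u *\<^sub>R f x + v *\<^sub>R f y"
  by (auto simp: affine_fun_on_def)

lemma affine_fun_on_subset: "affine_fun_on S f \<Longrightarrow> T \<subseteq> S \<Longrightarrow> affine_fun_on T f"
  unfolding affine_fun_on_def by blast

lemma affine_fun_on_inner_const:
  "affine_fun_on S (\<lambda>x. w \<bullet> x + c)" for w :: "'a::real_inner"
  unfolding affine_fun_on_def
proof (intro ballI allI impI)
  fix x y and u v :: real
  assume "u + v = 1"
  then have c: "u * c + v * c = c" by (metis distrib_right mult_1)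
  then show "w \<bullet> (u *\<^sub>R x + v *\<^sub>R y) + c = u *\<^sub>R (w \<bullet> x + c) + v *\<^sub>R (w \<bullet> y + c)"
    by (simp add: inner_add_right distrib_left)
qed

section \<open>Signs of convex combinations, convexity and closure of sign cells\<close>

lemma sgn_convex_comb:
  fixes a b :: real
  assumes "sgn b \<in> {0, sgn a}" "a \<noteq> 0" "0 \<le> v" "0 < u"
  shows "sgn (v * b + u * a) = sgn a"
proof (cases "a > 0")
  case True
  with assms(1) have "b \<ge> 0" by (auto simp: sgn_if split: if_splits)
  with assms True have "v * b + u * a > 0" by (simp add: add_nonneg_pos)
  with True show ?thesis by simp
next
  case False
  with assms(2) have a: "a < 0" by simp
  with assms(1) have "b \<le> 0" by (auto simp: sgn_if split: if_splits)
  with assms a have "v * b + u * a < 0"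
    by (meson add_nonpos_neg mult_nonneg_nonpos mult_pos_neg)
  with a show ?thesis by simp
qed

lemma sgn_le_convex_comb:
  fixes b c s :: real
  assumes "sgn b \<in> {0, s}" "sgn c \<in> {0, s}" "0 \<le> u" "0 \<le> v"
  shows "sgn (u * b + v * c) \<in> {0, s}"
proof (cases "v = 0 \<or> c = 0")
  case True
  then have "sgn (u * b + v * c) = sgn u * sgn b" by (auto simp: sgn_mult)
  moreover have "sgn u \<in> {0, 1}" using assms(3) by (auto simp: sgn_if)
  ultimately show ?thesis using assms(1) by auto
next
  case False
  then have "s = sgn c" using assms(2) by (auto simp: sgn_0_0)
  with False assms have "sgn (u * b + v * c) = sgn c"
    by (intro sgn_convex_comb) auto
  with \<open>s = sgn c\<close> show ?thesis by simp
qed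

lemma open_cell_subset_closed_cell: "open_cell V I f s \<subseteq> closed_cell V I f s"
  by (auto simp: open_cell_def closed_cell_def)

lemma closed_cell_self: "x \<in> V \<Longrightarrow> x \<in> closed_cell V I f (\<lambda>a. sgn (f a x))"
  by (auto simp: closed_cell_def)

lemma closed_closed_cell:
  assumes "closed V" "\<And>a. a \<in> I \<Longrightarrow> continuous_on UNIV (f a)"
  shows "closed (closed_cell V I f s)"
proof -
  have eq: "closed_cell V I f s = V \<inter> (\<Inter>a\<in>I. f a -` {b. sgn b \<in> {0, s a}})"
    by (auto simp: closed_cell_def)
  have "closed {b::real. sgn b \<in> {0, c}}" for c
  proof -
    \<comment> \<open>Any \<open>c\<close> other than 1 and -1, in particular 0, leaves only the
      point 0.\<close>
    have "{b::real. sgn b \<in> {0, c}} = (if c = 1 then {0..} else if c = -1 then {..0} else {0})"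
      by (auto simp: sgn_if split: if_splits)
    then show ?thesis by auto
  qed
  then have "closed (f a -` {b. sgn b \<in> {0, s a}})" if "a \<in> I" for a
    using closed_vimage assms(2)[OF that] by blast
  then show ?thesis unfolding eq using assms(1) by blast
qed

lemma convex_closed_cell:
  assumes "convex V" "\<And>a. a \<in> I \<Longrightarrow> affine_fun_on V (f a)"
  shows "convex (closed_cell V I f s)"
proof (rule convexI)
  fix x y and u v :: real
  assume xy: "x \<in> closed_cell V I f s" "y \<in> closed_cell V I f s"
    and uv: "0 \<le> u" "0 \<le> v" "u + v = 1"
  then have V: "x \<in> V" "y \<in> V" by (auto simp: closed_cell_def)
  have "sgn (f a (u *\<^sub>R x + v *\<^sub>R y)) \<in> {0, s a}" if "a \<in> I" for a
    using affine_fun_onD[OF assms(2)[OF that] V uv] sgn_le_convex_comb[of "f a x" "s a" "f a y" u v]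
      xy that uv by (auto simp: closed_cell_def)
  moreover have "u *\<^sub>R x + v *\<^sub>R y \<in> V" using convexD[OF assms(1) V uv] .
  ultimately show "u *\<^sub>R x + v *\<^sub>R y \<in> closed_cell V I f s" by (auto simp: closed_cell_def)
qed

text \<open>A point with strict signs, given positive weight, keeps its signs when mixed with a
  point that has them weakly. This segment principle yields both convexity and closure of open
  cells.\<close>

lemma open_cell_segment:
  assumes "convex (closed_cell V I f s)" "\<And>a. a \<in> I \<Longrightarrow> affine_fun_on (closed_cell V I f s) (f a)"
    and nz: "\<And>a. a \<in> I \<Longrightarrow> s a \<noteq> 0"
    and x: "x \<in> open_cell V I f s" and y: "y \<in> closed_cell V I f s"
    and uv: "0 < u" "0 \<le> v" "v + u = 1"
  shows "v *\<^sub>R y + u *\<^sub>R x \<in> open_cell V I f s"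
proof -
  have x': "x \<in> closed_cell V I f s"
    using x by (rule subsetD[OF open_cell_subset_closed_cell])
  have "sgn (f a (v *\<^sub>R y + u *\<^sub>R x)) = s a" if "a \<in> I" for a
  proof -
    have s: "s a = sgn (f a x)" using x that by (auto simp: open_cell_def)
    have "f a (v *\<^sub>R y + u *\<^sub>R x) = v * f a y + u * f a x"
      using affine_fun_onD[OF assms(2)[OF that] y x'] uv by simp
    also have "sgn \<dots> = sgn (f a x)"
      using y that nz[OF that] uv s by (intro sgn_convex_comb) (auto simp: closed_cell_def)
    finally show ?thesis using s by simp
  qed
  moreover have "v *\<^sub>R y + u *\<^sub>R x \<in> V"
    using convexD[OF assms(1) y x'] uv by (auto simp: closed_cell_def)
  ultimately show ?thesis by (auto simp: open_cell_def)
qed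

lemma convex_open_cell:
  assumes "convex (closed_cell V I f s)" "\<And>a. a \<in> I \<Longrightarrow> affine_fun_on (closed_cell V I f s) (f a)"
    and "\<And>a. a \<in> I \<Longrightarrow> s a \<noteq> 0"
  shows "convex (open_cell V I f s)"
proof (rule convexI)
  fix x y and u v :: real
  assume xy: "x \<in> open_cell V I f s" "y \<in> open_cell V I f s"
    and uv: "0 \<le> u" "0 \<le> v" "u + v = 1"
  show "u *\<^sub>R x + v *\<^sub>R y \<in> open_cell V I f s"
  proof (cases "v = 0")
    case True
    with uv xy show ?thesis by simp
  next
    case False
    with uv xy open_cell_subset_closed_cell[of V I f s] show ?thesis
      by (intro open_cell_segment[OF assms]) auto
  qed
qed

text \<open>Walking from a point \<open>y\<close> of the closed cell towards \<open>x\<close> enters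
  the open cell at once, so \<open>y\<close> is a limit of points with strict signs.\<close>

lemma closure_open_cell:
  fixes V :: "'a::real_normed_vector set"
  assumes "convex (closed_cell V I f s)" "\<And>a. a \<in> I \<Longrightarrow> affine_fun_on (closed_cell V I f s) (f a)"
    and "\<And>a. a \<in> I \<Longrightarrow> s a \<noteq> 0"
    and "closed (closed_cell V I f s)" and x: "x \<in> open_cell V I f s"
  shows "closure (open_cell V I f s) = closed_cell V I f s"
proof (rule antisym)
  show "closure (open_cell V I f s) \<subseteq> closed_cell V I f s"
    by (rule closure_minimal[OF open_cell_subset_closed_cell assms(4)])
next
  show "closed_cell V I f s \<subseteq> closure (open_cell V I f s)"
  proof
    fix y assume y: "y \<in> closed_cell V I f s"
    have "((\<lambda>u::real. (1 - u) *\<^sub>R y + u *\<^sub>R x) \<longlongrightarrow> (1 - 0) *\<^sub>R y + 0 *\<^sub>R x) (at_right 0)"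
      by (intro tendsto_intros)
    then have lim: "((\<lambda>u::real. (1 - u) *\<^sub>R y + u *\<^sub>R x) \<longlongrightarrow> y) (at_right 0)" by simp
    have "(1 - u) *\<^sub>R y + u *\<^sub>R x \<in> closure (open_cell V I f s)" if "0 < u" "u < 1" for u
      using that open_cell_segment[OF assms(1,2,3) x y, of u "1 - u"] closure_subset by fastforce
    then have "\<forall>\<^sub>F u in at_right 0. (1 - u) *\<^sub>R y + u *\<^sub>R x \<in> closure (open_cell V I f s)"
      unfolding eventually_at_right_field by (intro exI[of _ 1]) auto
    then show "y \<in> closure (open_cell V I f s)"
      by (rule Lim_in_closed_set[OF closed_closure _ _ lim]) simp
  qed
qed

text \<open>By the intermediate value theorem no sign changes on a connected set without zeros, so a
  component lies in one open cell; conversely open cells are connected by assumption. It serves both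
  for hyperplane arrangements and for activation regions.\<close>

lemma components_sign:
  fixes V :: "'a::topological_space set"
  assumes cont: "\<And>a. a \<in> I \<Longrightarrow> continuous_on V (f a)"
    and conn: "\<And>x. x \<in> V \<Longrightarrow> \<forall>a\<in>I. f a x \<noteq> 0 \<Longrightarrow> connected (open_cell V I f (\<lambda>a. sgn (f a x)))"
  shows "components {x \<in> V. \<forall>a\<in>I. f a x \<noteq> 0} =
    {open_cell V I f (\<lambda>a. sgn (f a x)) | x. x \<in> V \<and> (\<forall>a\<in>I. f a x \<noteq> 0)}"
proof -
  let ?U = "{x \<in> V. \<forall>a\<in>I. f a x \<noteq> 0}"
  have "connected_component_set ?U x = open_cell V I f (\<lambda>a. sgn (f a x))" if x: "x \<in> ?U" for x
  proof (rule antisym)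
    show "connected_component_set ?U x \<subseteq> open_cell V I f (\<lambda>a. sgn (f a x))"
    proof
      fix y assume y: "y \<in> connected_component_set ?U x"
      let ?K = "connected_component_set ?U x"
      have sub: "?K \<subseteq> ?U" by (rule connected_component_subset)
      have xK: "x \<in> ?K" using x by (simp add: connected_component_refl)
      have "sgn (f a y) = sgn (f a x)" if a: "a \<in> I" for a
      proof -
        have "continuous_on ?K (f a)"
          using cont[OF a] sub by (auto intro: continuous_on_subset)
        then have c: "connected (f a ` ?K)" by (intro connected_continuous_image) auto
        have "0 \<notin> f a ` ?K" using sub a by auto
        moreover have "f a x \<in> f a ` ?K" "f a y \<in> f a ` ?K" using xK y by blast+
        ultimately have "\<not> (f a x \<le> 0 \<and> 0 \<le> f a y)" "\<not> (f a y \<le> 0 \<and> 0 \<le> f a x)"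
          using connectedD_interval[OF c] by blast+
        then show ?thesis by (auto simp: sgn_if)
      qed
      with y sub show "y \<in> open_cell V I f (\<lambda>a. sgn (f a x))" by (auto simp: open_cell_def)
    qed
    show "open_cell V I f (\<lambda>a. sgn (f a x)) \<subseteq> connected_component_set ?U x"
    proof (rule connected_component_maximal)
      show "x \<in> open_cell V I f (\<lambda>a. sgn (f a x))" using x by (auto simp: open_cell_def)
      show "connected (open_cell V I f (\<lambda>a. sgn (f a x)))" using conn x by blast
      show "open_cell V I f (\<lambda>a. sgn (f a x)) \<subseteq> ?U"
        using x by (fastforce simp: open_cell_def sgn_0_0)
    qed
  qed
  then show ?thesis unfolding components_def by blast
qed

text \<open>The segment from \<open>y\<close> to the relative interior point \<open>x\<close> can be
  prolonged within \<open>T\<close> to some \<open>z\<close>. An affine function that does not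
  change sign and vanishes strictly between \<open>y\<close> and \<open>z\<close> vanishes at
  \<open>y\<close>.\<close>

lemma affine_sign_zero_at_rel_interior:
  fixes T :: "'a::euclidean_space set"
  assumes "convex T" "affine_fun_on T g" "x \<in> rel_interior T" "g x = (0::real)"
    and sg: "\<And>y. y \<in> T \<Longrightarrow> sgn (g y) \<in> {0, s}" and y: "y \<in> T"
  shows "g y = 0"
proof -
  have ne: "T \<noteq> {}" using y by auto
  obtain e where e: "e > 1" and z: "(1 - e) *\<^sub>R y + e *\<^sub>R x \<in> T"
    using assms(1,3) y convex_rel_interior_iff[OF assms(1) ne] by blast
  define z where "z = (1 - e) *\<^sub>R y + e *\<^sub>R x"
  let ?v = "1 / e"
  have x: "x = (1 - ?v) *\<^sub>R y + ?v *\<^sub>R z"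
  proof -
    have "?v *\<^sub>R z = (?v * (1 - e)) *\<^sub>R y + (?v * e) *\<^sub>R x"
      by (simp add: z_def scaleR_add_right)
    moreover have "?v * (1 - e) = - (1 - ?v)" "?v * e = 1" using e by (simp_all add: field_simps)
    ultimately have "?v *\<^sub>R z = - ((1 - ?v) *\<^sub>R y) + x"
      by (simp only: scaleR_minus_left scaleR_one)
    then show ?thesis by (simp only: add_minus_cancel)
  qed
  have zT: "z \<in> T" using z by (simp add: z_def)
  have "g x = (1 - ?v) * g y + ?v * g z"
    using affine_fun_onD[OF assms(2) y zT, of "1 - ?v" ?v] e x by simp
  then have "(1 - ?v) * g y + ?v * g z = 0" using assms(4) by simp
  \<comment> \<open>The weight \<open>1 - ?v\<close> of \<open>y\<close> is positive because
    \<open>e > 1\<close>, so a nonzero \<open>g y\<close> would dictate the sign of the value at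
    \<open>x\<close>.\<close>
  moreover have "sgn ((1 - ?v) * g y + ?v * g z) = sgn (g y)" if "g y \<noteq> 0"
    using sgn_convex_comb[of "g z" "g y" ?v "1 - ?v"] that sg[OF y] sg[OF zT] e
    by (auto simp: add.commute sgn_0_0)
  ultimately show ?thesis by (metis sgn_0 sgn_0_0)
qed

text \<open>This trades an abstract sign vector for that of an actual point. If \<open>T\<close> is
  the whole cell of \<open>s\<close>, the two inclusions make it the cell of \<open>w\<close>; for a
  proper face \<open>T\<close> they only bracket that cell.\<close>

lemma closed_cell_rel_interior:
  fixes V :: "'a::euclidean_space set"
  assumes sub: "T \<subseteq> closed_cell V I f s" and "convex T" "\<And>a. a \<in> I \<Longrightarrow> affine_fun_on T (f a)"
    and w: "w \<in> rel_interior T"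
  shows "T \<subseteq> closed_cell V I f (\<lambda>a. sgn (f a w))"
    and "closed_cell V I f (\<lambda>a. sgn (f a w)) \<subseteq> closed_cell V I f s"
proof -
  have wT: "w \<in> T" using w rel_interior_subset by blast
  show "T \<subseteq> closed_cell V I f (\<lambda>a. sgn (f a w))"
  proof
    fix y assume y: "y \<in> T"
    have "sgn (f a y) \<in> {0, sgn (f a w)}" if a: "a \<in> I" for a
    proof (cases "f a w = 0")
      case True
      have "f a y = 0"
        using affine_sign_zero_at_rel_interior[OF assms(2) assms(3)[OF a] w True _ y, of "s a"] sub a
        by (auto simp: closed_cell_def)
      then show ?thesis by simp
    next
      case False
      then show ?thesis
        using subsetD[OF sub wT] subsetD[OF sub y] a unfolding closed_cell_def by (force simp: sgn_0_0)
    qed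
    with y sub show "y \<in> closed_cell V I f (\<lambda>a. sgn (f a w))" by (auto simp: closed_cell_def)
  qed
  show "closed_cell V I f (\<lambda>a. sgn (f a w)) \<subseteq> closed_cell V I f s"
    using sub wT by (fastforce simp: closed_cell_def)
qed


section \<open>Hyperplane arrangements\<close>

text \<open>Induction: a vector good for \<open>J\<close> is shifted along the new normal
  \<open>w b\<close>, and only finitely many shifts are bad.\<close>

lemma exists_vector_off_hyperplanes:
  fixes w :: "'b \<Rightarrow> 'a::real_inner"
  assumes "subspace V" "finite I" "\<And>a. a \<in> I \<Longrightarrow> w a \<in> V \<and> w a \<noteq> 0"
  shows "\<exists>y\<in>V. \<forall>a\<in>I. w a \<bullet> y \<noteq> 0"
  using assms(2,3)
proof (induction I rule: finite_induct)
  case empty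
  then show ?case using subspace_0[OF assms(1)] by auto
next
  case (insert b J)
  then obtain y where y: "y \<in> V" "\<forall>a\<in>J. w a \<bullet> y \<noteq> 0" by auto
  \<comment> \<open>For each \<open>a\<close> not orthogonal to \<open>w b\<close> this is the only
    shift that puts the vector onto the hyperplane of \<open>a\<close>.\<close>
  let ?X = "(\<lambda>a. - (w a \<bullet> y) / (w a \<bullet> w b)) ` insert b J"
  have "finite (insert 0 ?X)" using insert by simp
  then obtain t where t: "t \<notin> insert 0 ?X" using ex_new_if_finite infinite_UNIV_char_0 by blast
  have "w a \<bullet> (y + t *\<^sub>R w b) \<noteq> 0" if a: "a \<in> insert b J" for a
  proof
    assume "w a \<bullet> (y + t *\<^sub>R w b) = 0"
    then have eq: "w a \<bullet> y + t * (w a \<bullet> w b) = 0" by (simp add: inner_add_right)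
    show False
    proof (cases "w a \<bullet> w b = 0")
      case True
      with eq y a have "a = b" by auto
      with True insert.prems show False by auto
    next
      case False
      with eq have "t = - (w a \<bullet> y) / (w a \<bullet> w b)" by (simp add: field_simps eq_neg_iff_add_eq_0)
      with t a show False by blast
    qed
  qed
  moreover have "y + t *\<^sub>R w b \<in> V"
    using assms(1) y insert.prems by (simp add: subspace_add subspace_scale)
  ultimately show ?case by blast
qed

lemma eventually_sgn_perturb:
  fixes a b :: real
  assumes "a \<noteq> 0"
  shows "\<forall>\<^sub>F e in at_right 0. sgn (a + e * b) = sgn a"
proof -
  have "((\<lambda>e. a + e * b) \<longlongrightarrow> a + 0 * b) (at_right 0)" by (intro tendsto_intros)
  then have lim: "((\<lambda>e. a + e * b) \<longlongrightarrow> a) (at_right 0)" by simp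
  show ?thesis
  proof (cases "a > 0")
    case True
    then show ?thesis using order_tendstoD(1)[OF lim, of 0] by (auto elim: eventually_mono)
  next
    case False
    then show ?thesis using order_tendstoD(2)[OF lim, of 0] assms by (auto elim: eventually_mono)
  qed
qed

text \<open>A face of a chamber is the sign cell of any of its relative interior points, by
  prolonging segments. Conversely, the sign cell of \<open>x\<close> is cut out of a chamber near
  \<open>x\<close> by one supporting hyperplane, the sum of those through \<open>x\<close> with
  suitable signs.\<close>

lemma nonempty_cells_arrangement_complex:
  fixes V :: "'a::euclidean_space set"
  assumes V: "subspace V" and fin: "finite I"
    and w: "\<And>a. a \<in> I \<Longrightarrow> w a \<in> V \<and> w a \<noteq> 0"
    and f: "\<And>a x. f a x = w a \<bullet> x + c a"
    and A: "\<Union>\<A> = {x \<in> V. \<exists>a\<in>I. f a x = 0}"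
  shows "arrangement_complex V \<A> - {{}} = {closed_cell V I f (\<lambda>a. sgn (f a x)) | x. x \<in> V}"
proof -
  have aff: "affine_fun_on S (f a)" for S a
    using affine_fun_on_inner_const[of S "w a" "c a"] f[of a] by (metis (no_types, lifting) ext)
  have cvx: "convex (closed_cell V I f s)" for s
    by (intro convex_closed_cell aff subspace_imp_convex V)
  have cont: "continuous_on S (f a)" for S a
    unfolding f[abs_def] by (intro continuous_intros)
  have clo: "closed (closed_cell V I f s)" for s
    by (intro closed_closed_cell closed_subspace V cont)
  have U: "V - \<Union>\<A> = {x \<in> V. \<forall>a\<in>I. f a x \<noteq> 0}" unfolding A by auto
  have comp: "components (V - \<Union>\<A>) =
      {open_cell V I f (\<lambda>a. sgn (f a x)) | x. x \<in> V \<and> (\<forall>a\<in>I. f a x \<noteq> 0)}"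
    unfolding U
    by (rule components_sign[OF cont])
      (intro convex_connected convex_open_cell cvx aff, auto simp: sgn_0_0)
  have chamber: "closure (open_cell V I f (\<lambda>a. sgn (f a x))) = closed_cell V I f (\<lambda>a. sgn (f a x))"
    if "x \<in> V" "\<forall>a\<in>I. f a x \<noteq> 0" for x
    using that by (intro closure_open_cell[where x = x] cvx aff clo) (auto simp: sgn_0_0 open_cell_def)
  show ?thesis
  proof (rule set_eqI, rule iffI)
    fix T assume T: "T \<in> arrangement_complex V \<A> - {{}}"
    then obtain x0 where x0: "x0 \<in> V" "\<forall>a\<in>I. f a x0 \<noteq> 0"
      and exp: "T exposed_face_of closed_cell V I f (\<lambda>a. sgn (f a x0))"
      unfolding arrangement_complex_def comp using chamber by force
    let ?Q = "closed_cell V I f (\<lambda>a. sgn (f a x0))"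
    have face: "T face_of ?Q" using exp by (simp add: exposed_face_of_def)
    then have cT: "convex T" and TQ: "T \<subseteq> ?Q" by (auto simp: face_of_imp_convex face_of_imp_subset)
    obtain x where x: "x \<in> rel_interior T"
      using T cT rel_interior_eq_empty by blast
    then have xT: "x \<in> T" using rel_interior_subset by blast
    then have xV: "x \<in> V" using TQ by (auto simp: closed_cell_def)
    have "closed_cell V I f (\<lambda>a. sgn (f a x)) \<subseteq> T"
    proof
      fix y assume y: "y \<in> closed_cell V I f (\<lambda>a. sgn (f a x))"
      then have yV: "y \<in> V" by (auto simp: closed_cell_def)
      have lin: "f a (x + e *\<^sub>R (x - y)) = f a x + e * (f a x - f a y)" for a e
        by (simp add: f inner_add_right inner_diff_right algebra_simps)
      \<comment> \<open>Where \<open>f a\<close> vanishes at \<open>x\<close> it also vanishes at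
        \<open>y\<close>, hence on the whole line; the other signs survive a small step, and
        \<open>I\<close> is finite.\<close>
      have "\<forall>\<^sub>F e in at_right 0. \<forall>a\<in>I. sgn (f a (x + e *\<^sub>R (x - y))) = sgn (f a x)"
      proof (rule eventually_ball_finite[OF fin], rule ballI)
        fix a assume a: "a \<in> I"
        show "\<forall>\<^sub>F e in at_right 0. sgn (f a (x + e *\<^sub>R (x - y))) = sgn (f a x)"
        proof (cases "f a x = 0")
          case True
          then show ?thesis using y a by (auto simp: lin closed_cell_def sgn_0_0)
        next
          case False
          then show ?thesis unfolding lin by (rule eventually_sgn_perturb)
        qed
      qed
      moreover have "\<forall>\<^sub>F e in at_right (0::real). e > 0" by (rule eventually_at_right_less)
      ultimately have "\<forall>\<^sub>F e in at_right (0::real). e > 0 \<and>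
          (\<forall>a\<in>I. sgn (f a (x + e *\<^sub>R (x - y))) = sgn (f a x))"
        by eventually_elim auto
      then obtain e where e: "e > 0" "\<forall>a\<in>I. sgn (f a (x + e *\<^sub>R (x - y))) = sgn (f a x)"
        using eventually_happens trivial_limit_at_right_real by blast
      \<comment> \<open>A point slightly beyond \<open>x\<close> as seen from \<open>y\<close>. Both
        ends lie in the chamber closure and \<open>x\<close> in the face, so the face property
        captures \<open>y\<close>.\<close>
      define z where "z = x + e *\<^sub>R (x - y)"
      have zV: "z \<in> V" unfolding z_def
        using V xV yV by (simp add: subspace_add subspace_diff subspace_scale)
      have sub: "closed_cell V I f (\<lambda>a. sgn (f a x)) \<subseteq> ?Q"
        using closed_cell_rel_interior(2)[OF TQ cT aff x] .
      have "z \<in> closed_cell V I f (\<lambda>a. sgn (f a x))"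
        using zV e by (auto simp: z_def closed_cell_def)
      then have "z \<in> ?Q" using sub by blast
      moreover have "y \<in> ?Q" using sub y by blast
      moreover have "x \<in> open_segment y z" if "y \<noteq> x"
      proof -
        have "x = (1 - 1 / (1 + e)) *\<^sub>R y + (1 / (1 + e)) *\<^sub>R z"
        proof -
          have "z = (1 + e) *\<^sub>R x - e *\<^sub>R y" by (simp add: z_def algebra_simps)
          then have "(1 / (1 + e)) *\<^sub>R z = x - (e / (1 + e)) *\<^sub>R y"
            using e by (simp add: scaleR_diff_right)
          moreover have "1 - 1 / (1 + e) = e / (1 + e)" using e by (simp add: field_simps)
          ultimately show ?thesis by simp
        qed
        moreover have "y \<noteq> z"
        proof
          assume "y = z"
          then have "(1 + e) *\<^sub>R (x - y) = 0" by (simp add: z_def algebra_simps)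
          with e that show False by simp
        qed
        ultimately show ?thesis unfolding in_segment
          using e by (intro conjI exI[of _ "1 / (1 + e)"]) auto
      qed
      ultimately show "y \<in> T" using face xT unfolding face_of_def by blast
    qed
    with closed_cell_rel_interior(1)[OF TQ cT aff x]
    have "T = closed_cell V I f (\<lambda>a. sgn (f a x))" by blast
    with xV show "T \<in> {closed_cell V I f (\<lambda>a. sgn (f a x)) | x. x \<in> V}" by blast
  next
    fix T assume "T \<in> {closed_cell V I f (\<lambda>a. sgn (f a x)) | x. x \<in> V}"
    then obtain x where x: "x \<in> V" and T: "T = closed_cell V I f (\<lambda>a. sgn (f a x))" by blast
    obtain y where y: "y \<in> V" "\<forall>a\<in>I. w a \<bullet> y \<noteq> 0"
      using exists_vector_off_hyperplanes[OF V fin, of w] w by blast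
    have lin: "f a (x + e *\<^sub>R y) = f a x + e * (w a \<bullet> y)" for a e
      by (simp add: f inner_add_right)
    have "\<forall>\<^sub>F e in at_right 0. \<forall>a\<in>I. f a x \<noteq> 0 \<longrightarrow> sgn (f a (x + e *\<^sub>R y)) = sgn (f a x)"
      unfolding lin using eventually_sgn_perturb
      by (intro eventually_ball_finite[OF fin] ballI) (auto simp: eventually_conj_iff)
    moreover have "\<forall>\<^sub>F e in at_right (0::real). e > 0" by (rule eventually_at_right_less)
    ultimately have "\<forall>\<^sub>F e in at_right (0::real). e > 0 \<and>
        (\<forall>a\<in>I. f a x \<noteq> 0 \<longrightarrow> sgn (f a (x + e *\<^sub>R y)) = sgn (f a x))"
      by eventually_elim auto
    then obtain e where e: "e > 0"
      and es: "\<forall>a\<in>I. f a x \<noteq> 0 \<longrightarrow> sgn (f a (x + e *\<^sub>R y)) = sgn (f a x)"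
      using eventually_happens trivial_limit_at_right_real by blast
    \<comment> \<open>The direction \<open>y\<close> is parallel to none of the hyperplanes, so
      \<open>x0\<close> leaves those through \<open>x\<close> and, for small \<open>e\<close>, stays
      on the same side of the others.\<close>
    define x0 where "x0 = x + e *\<^sub>R y"
    have x0V: "x0 \<in> V" unfolding x0_def using V x y by (simp add: subspace_add subspace_scale)
    have x0nz: "\<forall>a\<in>I. f a x0 \<noteq> 0"
    proof
      fix a assume a: "a \<in> I"
      show "f a x0 \<noteq> 0"
        using es a y e by (cases "f a x = 0") (auto simp: x0_def lin sgn_0_0 dest!: bspec)
    qed
    let ?Q = "closed_cell V I f (\<lambda>a. sgn (f a x0))"
    define K where "K = {a \<in> I. f a x = 0}"
    have finK: "finite K" using fin by (simp add: K_def)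
    \<comment> \<open>Each function vanishing at \<open>x\<close> is weighted with its sign at
      \<open>x0\<close>, which makes it nonnegative on \<open>?Q\<close>; the minus sign turns the
      sum into the form \<open>W \<bullet> z \<le> B\<close>. For empty \<open>K\<close> the normal
      is zero and the face is \<open>?Q\<close> itself.\<close>
    define W where "W = (\<Sum>a\<in>K. - sgn (f a x0) *\<^sub>R w a)"
    define B where "B = (\<Sum>a\<in>K. sgn (f a x0) * c a)"
    have WB: "W \<bullet> z - B = - (\<Sum>a\<in>K. sgn (f a x0) * f a z)" for z
      by (simp add: W_def B_def f inner_sum_left sum_negf algebra_simps sum.distrib)
    have nonneg: "0 \<le> sgn (f a x0) * f a z" if "z \<in> ?Q" "a \<in> K" for a z
      using that by (auto simp: closed_cell_def K_def sgn_if split: if_splits)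
    have sub: "T \<subseteq> ?Q" unfolding T
      using es by (auto simp: closed_cell_def x0_def) (metis sgn_0 sgn_0_0)
    have Teq: "T = ?Q \<inter> {z. W \<bullet> z = B}"
    proof (intro equalityI subsetI IntI)
      fix z assume z: "z \<in> T"
      then show "z \<in> ?Q" using sub by blast
      have "\<forall>a\<in>K. f a z = 0" using z by (auto simp: T closed_cell_def K_def sgn_0_0)
      then have "(\<Sum>a\<in>K. sgn (f a x0) * f a z) = 0" by simp
      then show "z \<in> {z. W \<bullet> z = B}" using WB[of z] by simp
    next
      fix z assume "z \<in> ?Q \<inter> {z. W \<bullet> z = B}"
      then have z: "z \<in> ?Q" and "W \<bullet> z = B" by auto
      then have "(\<Sum>a\<in>K. sgn (f a x0) * f a z) = 0" using WB[of z] by simp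
      \<comment> \<open>A vanishing sum of nonnegative terms has only zero terms.\<close>
      then have "\<forall>a\<in>K. sgn (f a x0) * f a z = 0"
        using sum_nonneg_eq_0_iff[OF finK] nonneg[OF z] by (metis (no_types, lifting))
      then have "\<forall>a\<in>K. f a z = 0" using x0nz by (auto simp: K_def sgn_0_0)
      moreover have "sgn (f a x0) = sgn (f a x)" if "a \<in> I - K" for a
        using es that by (auto simp: K_def x0_def)
      ultimately have "sgn (f a z) \<in> {0, sgn (f a x)}" if "a \<in> I" for a
        using z that by (cases "a \<in> K") (auto simp: closed_cell_def)
      then show "z \<in> T" using z by (auto simp: T closed_cell_def)
    qed
    have "W \<bullet> z \<le> B" if "z \<in> ?Q" for z
    proof -
      have "0 \<le> (\<Sum>a\<in>K. sgn (f a x0) * f a z)" by (intro sum_nonneg nonneg that)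
      then show ?thesis using WB[of z] by simp
    qed
    then have "T exposed_face_of ?Q"
      unfolding Teq by (intro exposed_face_of_Int_supporting_hyperplane_le cvx) auto
    then have "T \<in> arrangement_complex V \<A>"
      unfolding arrangement_complex_def comp chamber[OF x0V x0nz, symmetric]
      using x0V x0nz by blast
    moreover have "T \<noteq> {}" using x unfolding T by (auto simp: closed_cell_def)
    ultimately show "T \<in> arrangement_complex V \<A> - {{}}" by blast
  qed
qed


section \<open>The canonical complex of a ReLU network\<close>

abbreviation nodes :: "'k::finite relu_network \<Rightarrow> nat \<Rightarrow> (nat \<times> 'k) set" where
  "nodes N k \<equiv> Sigma {1..k} (units N)"

abbreviation node :: "'k::finite relu_network \<Rightarrow> nat \<times> 'k \<Rightarrow> real ^ 'k \<Rightarrow> real" where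
  "node N \<equiv> \<lambda>(i, j). node_map N i j"

abbreviation network_cell ::
    "'k::finite relu_network \<Rightarrow> nat \<Rightarrow> (nat \<times> 'k \<Rightarrow> real) \<Rightarrow> (real ^ 'k) set" where
  "network_cell N k \<equiv> closed_cell (layer_space N 0) (nodes N k) (node N)"

text \<open>For \<open>k = m\<close> this is the set called \<open>Q x\<close> in the opening
  comment; smaller \<open>k\<close> belong to the preceding complexes.\<close>

abbreviation point_cell ::
    "'k::finite relu_network \<Rightarrow> nat \<Rightarrow> real ^ 'k \<Rightarrow> (real ^ 'k) set" where
  "point_cell N k x \<equiv> network_cell N k (\<lambda>p. sgn (node N p x))"

lemma subspace_layer_space: "subspace (layer_space N i)"
  by (auto simp: layer_space_def coord_space_def subspace_def)

lemma aff_dim_layer_space: "aff_dim (layer_space N i) = int (card (units N i))"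
  using aff_dim_subspace[OF subspace_layer_space, of N i] dim_substandard_cart[where 'a = real, of "units N i"]
  by (simp add: layer_space_def coord_space_def dim_vec_eq)

lemma affine_layer_nth: "affine_layer N i x $ j = weight N i $ j \<bullet> x + bias N i $ j"
  by (simp add: affine_layer_def matrix_vector_mult_def inner_vec_def)

lemma continuous_hidden_map: "continuous_on UNIV (hidden_map N k)"
proof (induction k)
  case 0
  then show ?case by (simp add: continuous_on_id id_def)
next
  case (Suc k)
  have "continuous_on UNIV (\<lambda>x. relu (affine_layer N (Suc k) x))"
    unfolding relu_def affine_layer_nth by (intro continuous_intros)
  then show ?case using Suc
    by (auto simp: layer_map_def o_def intro: continuous_on_compose2)
qed

lemma continuous_node: "continuous_on UNIV (node N p)"
  by (cases p) (auto simp: node_map_def affine_layer_nth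
      intro!: continuous_intros continuous_hidden_map)

lemma network_cell_0: "network_cell N 0 s = layer_space N 0"
  by (auto simp: closed_cell_def)

text \<open>Layer \<open>Suc k\<close> subdivides cells of the first \<open>k\<close> layers, on
  which its node maps are already affine; the results on sign cells apply inside each of
  them.\<close>

lemma network_cell_Suc:
  "network_cell N (Suc k) s =
     closed_cell (network_cell N k s) (units N (Suc k)) (\<lambda>j. node_map N (Suc k) j) (\<lambda>j. s (Suc k, j))"
  by (auto simp: closed_cell_def atLeastAtMostSuc_conv)

lemma closed_network_cell: "closed (network_cell N k s)"
  by (intro closed_closed_cell closed_subspace subspace_layer_space continuous_node)

lemma network_cell_antimono: "i \<le> k \<Longrightarrow> network_cell N k s \<subseteq> network_cell N i s"
  by (auto simp: closed_cell_def)

lemma nodes_finite: "finite (nodes N k)"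
  by (intro finite_SigmaI) auto

section \<open>Affinity on cells and description of the canonical complex\<close>

context
  fixes N :: "'k::finite relu_network" and m :: nat and n :: "nat \<Rightarrow> nat"
  assumes arch: "has_architecture N m n"
begin

lemma affine_layer_nth_outside:
  assumes "1 \<le> i" "i \<le> m + 1" "j \<notin> units N i"
  shows "affine_layer N i x $ j = 0"
proof -
  have "weight N i $ j $ l = 0" for l using arch assms unfolding has_architecture_def by force
  then have "weight N i $ j = 0" by (simp add: vec_eq_iff)
  moreover have "bias N i $ j = 0" using arch assms unfolding has_architecture_def by force
  ultimately show ?thesis by (simp add: affine_layer_nth)
qed

lemma weight_row_in_layer_space:
  assumes "1 \<le> i" "i \<le> m + 1"
  shows "weight N i $ j \<in> layer_space N (i - 1)"
proof -
  have "weight N i $ j $ l \<noteq> 0 \<longrightarrow> l \<in> units N (i - 1)" for l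
    using arch assms unfolding has_architecture_def by simp
  then show ?thesis by (auto simp: layer_space_def coord_space_def)
qed

lemma hidden_map_in_layer_space:
  assumes "x \<in> layer_space N 0" "k \<le> m"
  shows "hidden_map N k x \<in> layer_space N k"
proof (cases k)
  case 0
  then show ?thesis using assms by simp
next
  case (Suc l)
  then show ?thesis using assms affine_layer_nth_outside[of k]
    by (auto simp: layer_space_def coord_space_def layer_map_def relu_def)
qed

text \<open>Both claims go through one induction: affinity of \<open>hidden_map N k\<close> makes
  the next cell convex, and on that cell every preactivation has a constant weak sign, so ReLU acts
  linearly on it.\<close>

lemma convex_network_cell_and_affine_hidden_map:
  assumes "k \<le> m"
  shows "convex (network_cell N k s) \<and> affine_fun_on (network_cell N k s) (hidden_map N k)"
  using assms
proof (induction k)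
  case 0
  show ?case unfolding network_cell_0
    using subspace_imp_convex[OF subspace_layer_space] by (auto simp: affine_fun_on_def)
next
  case (Suc k)
  let ?P = "network_cell N k s" and ?Q = "network_cell N (Suc k) s"
  have IH: "convex ?P" "affine_fun_on ?P (hidden_map N k)" using Suc by auto
  have aff: "affine_fun_on ?P (\<lambda>x. affine_layer N (Suc k) (hidden_map N k x) $ j)" for j
  proof -
    have "affine_fun_on UNIV (\<lambda>x. affine_layer N (Suc k) x $ j)"
      unfolding affine_layer_nth by (rule affine_fun_on_inner_const)
    then show ?thesis using IH(2) unfolding affine_fun_on_def by simp
  qed
  then have aff_node: "affine_fun_on ?P (node_map N (Suc k) j)" for j
    by (simp add: node_map_def[abs_def])
  have cvx: "convex ?Q" unfolding network_cell_Suc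
    by (intro convex_closed_cell IH aff_node)
  have QP: "?Q \<subseteq> ?P" by (rule network_cell_antimono) simp
  have "hidden_map N (Suc k) (u *\<^sub>R x + v *\<^sub>R y) =
      u *\<^sub>R hidden_map N (Suc k) x + v *\<^sub>R hidden_map N (Suc k) y"
    if xy: "x \<in> ?Q" "y \<in> ?Q" and uv: "0 \<le> u" "0 \<le> v" "u + v = 1" for x y and u v :: real
  proof (rule vec_eq_iff[THEN iffD2], rule allI)
    fix j
    let ?g = "\<lambda>x. affine_layer N (Suc k) (hidden_map N k x) $ j"
    have sg: "\<exists>c. \<forall>z\<in>?Q. sgn (?g z) \<in> {0, c}"
    proof (cases "j \<in> units N (Suc k)")
      case True
      then show ?thesis unfolding network_cell_Suc
        by (intro exI[of _ "s (Suc k, j)"]) (auto simp: closed_cell_def node_map_def)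
    next
      case False
      \<comment> \<open>Coordinates outside the layer have preactivation 0, so any \<open>c\<close>
        serves.\<close>
      then show ?thesis using affine_layer_nth_outside Suc.prems by auto
    qed
    then obtain c where c: "\<And>z. z \<in> ?Q \<Longrightarrow> sgn (?g z) \<in> {0, c}" by blast
    \<comment> \<open>If \<open>c = 1\<close> the preactivation is nonnegative and ReLU is the
      identity on it; otherwise it is at most 0 and ReLU gives 0.\<close>
    define t :: real where "t = (if c = 1 then 1 else 0)"
    have relu: "max 0 (?g z) = t * ?g z" if "z \<in> ?Q" for z
      using c[OF that] by (auto simp: t_def sgn_if split: if_splits)
    have z: "u *\<^sub>R x + v *\<^sub>R y \<in> ?Q" using convexD[OF cvx xy uv] .
    have "?g (u *\<^sub>R x + v *\<^sub>R y) = u * ?g x + v * ?g y"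
      using affine_fun_onD[OF affine_fun_on_subset[OF aff QP] xy uv] by simp
    then have "max 0 (?g (u *\<^sub>R x + v *\<^sub>R y)) = u * max 0 (?g x) + v * max 0 (?g y)"
      unfolding relu[OF z] relu[OF xy(1)] relu[OF xy(2)] by (simp add: algebra_simps)
    then show "hidden_map N (Suc k) (u *\<^sub>R x + v *\<^sub>R y) $ j =
      (u *\<^sub>R hidden_map N (Suc k) x + v *\<^sub>R hidden_map N (Suc k) y) $ j"
      by (simp add: layer_map_def relu_def)
  qed
  then have "affine_fun_on ?Q (hidden_map N (Suc k))" unfolding affine_fun_on_def by blast
  with cvx show ?case by blast
qed

lemma convex_network_cell: "k \<le> m \<Longrightarrow> convex (network_cell N k s)"
  using convex_network_cell_and_affine_hidden_map by blast

text \<open>The bound \<open>Suc k\<close> is intended: a node of the next layer only composes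
  \<open>hidden_map N k\<close> with an affine map, before any further ReLU.\<close>

lemma affine_node_network_cell:
  assumes "k \<le> m" "1 \<le> i" "i \<le> Suc k"
  shows "affine_fun_on (network_cell N k s) (node_map N i j)"
proof -
  have "affine_fun_on (network_cell N (i - 1) s) (hidden_map N (i - 1))"
    using convex_network_cell_and_affine_hidden_map assms by simp
  then have hid: "affine_fun_on (network_cell N k s) (hidden_map N (i - 1))"
    by (rule affine_fun_on_subset[OF _ network_cell_antimono]) (use assms in simp)
  have "affine_fun_on UNIV (\<lambda>x. affine_layer N i x $ j)"
    unfolding affine_layer_nth by (rule affine_fun_on_inner_const)
  with hid show ?thesis unfolding affine_fun_on_def node_map_def by simp
qed

lemma nonempty_cells_layer_complex:
  assumes "1 \<le> k" "k \<le> m"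
  shows "layer_complex N k - {{}} =
    {closed_cell (layer_space N (k - 1)) (units N k) (\<lambda>j y. affine_layer N k y $ j)
       (\<lambda>j. sgn (affine_layer N k z $ j)) | z. z \<in> layer_space N (k - 1)}"
proof -
  let ?V = "layer_space N (k - 1)"
  let ?f = "\<lambda>j y. affine_layer N k y $ j"
  let ?J = "{j \<in> units N k. weight N k $ j \<noteq> 0}"
  have "layer_complex N k - {{}} = {closed_cell ?V ?J ?f (\<lambda>j. sgn (?f j z)) | z. z \<in> ?V}"
    unfolding layer_complex_def
  proof (rule nonempty_cells_arrangement_complex[where w = "\<lambda>j. weight N k $ j" and c = "\<lambda>j. bias N k $ j"])
    show "\<Union> (layer_arrangement N k) = {x \<in> ?V. \<exists>a\<in>?J. ?f a x = 0}"
      by (auto simp: layer_arrangement_def affine_layer_nth)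
    show "weight N k $ j \<in> ?V \<and> weight N k $ j \<noteq> 0" if "j \<in> ?J" for j
      using weight_row_in_layer_space[of k j] assms that by auto
  qed (auto simp: subspace_layer_space affine_layer_nth)
  \<comment> \<open>A zero row gives a constant function, whose sign condition holds everywhere; so
    the index set may be enlarged to all units.\<close>
  moreover have "closed_cell ?V ?J ?f (\<lambda>j. sgn (?f j z)) = closed_cell ?V (units N k) ?f (\<lambda>j. sgn (?f j z))" for z
    by (fastforce simp: closed_cell_def affine_layer_nth)
  ultimately show ?thesis by simp
qed

lemma point_cell_Suc:
  assumes "k \<le> m"
  shows "point_cell N (Suc k) x = point_cell N k x \<inter> {y \<in> layer_space N 0. hidden_map N k y \<in>
    closed_cell (layer_space N k) (units N (Suc k)) (\<lambda>j y. affine_layer N (Suc k) y $ j)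
       (\<lambda>j. sgn (affine_layer N (Suc k) (hidden_map N k x) $ j))}"
proof -
  have "\<forall>y\<in>layer_space N 0. hidden_map N k y \<in> layer_space N k"
    using hidden_map_in_layer_space[OF _ assms] by blast
  then show ?thesis
    unfolding network_cell_Suc by (auto simp: closed_cell_def node_map_def)
qed

text \<open>Intersecting a cell with the preimage of a layer cell combines sign conditions. If the
  result is nonempty, a relative interior point of it realises a sign vector that describes the same
  set.\<close>

lemma nonempty_cells_canonical_complex:
  assumes "k \<le> m"
  shows "canonical_complex_upto N k - {{}} = {point_cell N k x | x. x \<in> layer_space N 0}"
  using assms
proof (induction k)
  case 0
  show ?case unfolding network_cell_0
    using subspace_0[OF subspace_layer_space[of N 0]] by auto
next
  case (Suc k)
  let ?V = "layer_space N 0"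
  let ?L = "\<lambda>z. closed_cell (layer_space N k) (units N (Suc k)) (\<lambda>j y. affine_layer N (Suc k) y $ j)
       (\<lambda>j. sgn (affine_layer N (Suc k) z $ j))"
  have layer: "layer_complex N (Suc k) - {{}} = {?L z | z. z \<in> layer_space N k}"
    using nonempty_cells_layer_complex[of "Suc k"] Suc.prems by simp
  have km: "k \<le> m" using Suc.prems by simp
  show ?case
  proof (cases k)
    \<comment> \<open>The first layer has its own clause in the definition of the complex and needs
      no preimage.\<close>
    case 0
    have "point_cell N (Suc 0) x = ?L x" for x
      unfolding network_cell_Suc network_cell_0 by (simp add: 0 node_map_def[abs_def])
    with layer show ?thesis unfolding 0 by simp
  next
    case (Suc l)
    have canon: "canonical_complex_upto N (Suc k) =
        {S \<inter> {x \<in> ?V. hidden_map N k x \<in> Y} | S Y.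
          S \<in> canonical_complex_upto N k \<and> Y \<in> layer_complex N (Suc k)}"
      unfolding Suc by simp
    show ?thesis
    proof (rule set_eqI, rule iffI)
      fix T assume T: "T \<in> canonical_complex_upto N (Suc k) - {{}}"
      then obtain S Y where SY: "S \<in> canonical_complex_upto N k" "Y \<in> layer_complex N (Suc k)"
        and TSY: "T = S \<inter> {x \<in> ?V. hidden_map N k x \<in> Y}" and ne: "T \<noteq> {}"
        unfolding canon by blast
      then have "S \<in> canonical_complex_upto N k - {{}}" "Y \<in> layer_complex N (Suc k) - {{}}" by auto
      then obtain x z where S: "S = point_cell N k x" and Y: "Y = ?L z"
        unfolding Suc.IH[OF km] layer by blast
      \<comment> \<open>Signs of \<open>x\<close> on the first \<open>k\<close> layers are glued to
        those of \<open>z\<close> on layer \<open>Suc k\<close>. No point need have exactly these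
        signs, hence the passage to \<open>w\<close> below.\<close>
      define s where "s = (\<lambda>(i, j). if i = Suc k then sgn (affine_layer N (Suc k) z $ j)
        else sgn (node_map N i j x))"
      have "network_cell N k s = S"
        unfolding S by (auto simp: closed_cell_def s_def)
      then have Ts: "T = network_cell N (Suc k) s"
        unfolding network_cell_Suc TSY Y
        using hidden_map_in_layer_space[OF _ km]
        by (auto simp: closed_cell_def s_def node_map_def)
      have cT: "convex T" unfolding Ts by (rule convex_network_cell[OF Suc.prems])
      have aff: "affine_fun_on T (node N p)" if "p \<in> nodes N (Suc k)" for p
        using that affine_node_network_cell[OF Suc.prems] unfolding Ts by auto
      obtain w where w: "w \<in> rel_interior T"
        using ne cT rel_interior_eq_empty by blast
      then have "w \<in> ?V" using rel_interior_subset Ts by (auto simp: closed_cell_def)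
      moreover have "T = point_cell N (Suc k) w"
        using closed_cell_rel_interior[OF eq_refl[OF Ts] cT aff w] Ts by blast
      ultimately show "T \<in> {point_cell N (Suc k) x | x. x \<in> ?V}" by blast
    next
      fix T assume "T \<in> {point_cell N (Suc k) x | x. x \<in> ?V}"
      then obtain x where x: "x \<in> ?V" and T: "T = point_cell N (Suc k) x" by blast
      have "point_cell N k x \<in> canonical_complex_upto N k" using Suc.IH[OF km] x by blast
      moreover have "?L (hidden_map N k x) \<in> layer_complex N (Suc k)"
        using layer hidden_map_in_layer_space[OF x km] by blast
      ultimately have "T \<in> canonical_complex_upto N (Suc k)"
        unfolding canon T point_cell_Suc[OF km] by blast
      moreover have "T \<noteq> {}" using closed_cell_self[OF x] unfolding T by blast
      ultimately show "T \<in> canonical_complex_upto N (Suc k) - {{}}" by blast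
    qed
  qed
qed

end


section \<open>Transversality\<close>

text \<open>A function vanishing on the relative interior has derivative zero along the affine hull,
  so the derivative could not be onto.\<close>

lemma transversal_on_cell_not_vanishing:
  fixes f :: "'a::euclidean_space \<Rightarrow> real"
  assumes "transversal_on_cell f C 0" "convex C" "C \<noteq> {}"
  shows "\<exists>x\<in>C. f x \<noteq> 0"
proof (rule ccontr)
  assume "\<not> ?thesis"
  then have zero: "f x = 0" if "x \<in> rel_interior C" for x
    using that rel_interior_subset by blast
  obtain x where x: "x \<in> rel_interior C"
    using assms(2,3) rel_interior_eq_empty by blast
  obtain D where D: "(f has_derivative D) (at x within rel_interior C)"
    and onto: "D ` {y - x | y. y \<in> affine hull C} = UNIV"
    using assms(1) x zero[OF x] unfolding transversal_on_cell_def by blast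
  have "1 \<in> D ` {y - x | y. y \<in> affine hull C}" unfolding onto by simp
  then obtain y where y: "y \<in> affine hull C" and Dy: "D (y - x) = 1" by (auto simp: image_iff)
  have "openin (top_of_set (affine hull C)) (rel_interior C)" by (rule openin_rel_interior)
  then obtain U where U: "open U" "rel_interior C = affine hull C \<inter> U"
    by (auto simp: openin_open)
  \<comment> \<open>The line through \<open>x\<close> in a direction on which \<open>D\<close> takes
    the value 1. Near parameter 0 it stays in the relative interior, so \<open>f \<circ> g\<close>
    is locally 0 and uniqueness of the ordinary derivative at 0 gives the contradiction.\<close>
  define g where "g = (\<lambda>t::real. x + t *\<^sub>R (y - x))"
  have xh: "x \<in> affine hull C" using x U by blast
  have gh: "g t \<in> affine hull C" for t
    using mem_affine[OF affine_affine_hull xh y, of "1 - t" t]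
    by (simp add: g_def algebra_simps)
  let ?T = "g -` U"
  have "continuous_on UNIV g" unfolding g_def by (intro continuous_intros)
  then have T: "open ?T" using U(1) by (rule open_vimage[rotated])
  have T0: "0 \<in> ?T" using x U by (simp add: g_def)
  have gT: "g ` ?T \<subseteq> rel_interior C" using gh U by auto
  have "(g has_derivative (\<lambda>t. t *\<^sub>R (y - x))) (at 0 within ?T)"
    unfolding g_def by (auto intro!: derivative_eq_intros)
  moreover have "(f has_derivative D) (at (g 0) within g ` ?T)"
    using has_derivative_subset[OF D gT] by (simp add: g_def)
  ultimately have "(f \<circ> g has_derivative D \<circ> (\<lambda>t. t *\<^sub>R (y - x))) (at 0 within ?T)"
    by (rule diff_chain_within)
  then have "(f \<circ> g has_derivative D \<circ> (\<lambda>t. t *\<^sub>R (y - x))) (at 0)"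
    by (simp add: at_within_open[OF T0 T])
  moreover have "((\<lambda>t. 0) has_derivative (\<lambda>t. 0)) (at (0::real))" by simp
  then have "(f \<circ> g has_derivative (\<lambda>t. 0)) (at 0)"
    by (rule has_derivative_transform_within_open[OF _ T T0]) (use gT zero in auto)
  ultimately have "D \<circ> (\<lambda>t. t *\<^sub>R (y - x)) = (\<lambda>t. 0)"
    by (rule has_derivative_unique)
  then have "D (1 *\<^sub>R (y - x)) = 0" by (metis comp_apply)
  with Dy show False by simp
qed

text \<open>Cells of positive dimension are covered by the derivative condition, single points by
  the separate condition on vertices.\<close>

lemma transversal_threshold_not_vanishing:
  assumes "transversal_threshold f M 0" "C \<in> M" "convex C" "C \<noteq> {}"
  shows "\<exists>x\<in>C. f x \<noteq> 0"
proof (cases "1 \<le> aff_dim C")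
  case True
  then show ?thesis
    using assms transversal_on_cell_not_vanishing unfolding transversal_threshold_def by blast
next
  case False
  with assms(4) have "aff_dim C = 0"
    using aff_dim_geq[of C] aff_dim_empty[of C] by linarith
  then obtain v where "C = {v}" using aff_dim_eq_0 by blast
  then show ?thesis using assms unfolding transversal_threshold_def by blast
qed

text \<open>From a relative interior point \<open>x\<close> of \<open>P\<close>, a short step
  towards \<open>y\<close> stays in \<open>P\<close>, because \<open>y\<close> lies in the affine
  hull. Along this segment \<open>g\<close> is affine with two zeros, hence zero at
  \<open>y\<close>.\<close>

lemma affine_fun_zero_on_full_subset:
  fixes P :: "'a::euclidean_space set"
  assumes "convex P" "P \<noteq> {}" "P \<subseteq> C" "C \<subseteq> affine hull P"
    and aff: "affine_fun_on C g" and zero: "\<And>x. x \<in> P \<Longrightarrow> g x = (0::real)" and y: "y \<in> C"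
  shows "g y = 0"
proof -
  obtain x where x: "x \<in> rel_interior P" using assms(1,2) rel_interior_eq_empty by blast
  then have xP: "x \<in> P" using rel_interior_subset by blast
  have yh: "y \<in> affine hull P" and xh: "x \<in> affine hull P"
    using y assms(4) xP by (auto simp: hull_inc)
  obtain U where U: "open U" "rel_interior P = affine hull P \<inter> U"
    using openin_rel_interior[of P] by (auto simp: openin_open)
  have "((\<lambda>t::real. (1 - t) *\<^sub>R x + t *\<^sub>R y) \<longlongrightarrow> (1 - 0) *\<^sub>R x + 0 *\<^sub>R y) (at_right 0)"
    by (intro tendsto_intros)
  then have "((\<lambda>t::real. (1 - t) *\<^sub>R x + t *\<^sub>R y) \<longlongrightarrow> x) (at_right 0)" by simp
  then have "\<forall>\<^sub>F t in at_right 0. (1 - t) *\<^sub>R x + t *\<^sub>R y \<in> U"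
    using topological_tendstoD U x by blast
  moreover have "\<forall>\<^sub>F t in at_right (0::real). 0 < t \<and> t < 1"
    unfolding eventually_at_right_field by (intro exI[of _ 1]) auto
  ultimately have "\<forall>\<^sub>F t in at_right (0::real). 0 < t \<and> t < 1 \<and> (1 - t) *\<^sub>R x + t *\<^sub>R y \<in> U"
    by eventually_elim auto
  then obtain t where t: "0 < t" "t < 1" "(1 - t) *\<^sub>R x + t *\<^sub>R y \<in> U"
    using eventually_happens trivial_limit_at_right_real by blast
  have "(1 - t) *\<^sub>R x + t *\<^sub>R y \<in> affine hull P"
    using mem_affine[OF affine_affine_hull xh yh, of "1 - t" t] by simp
  with t U have "(1 - t) *\<^sub>R x + t *\<^sub>R y \<in> P" using rel_interior_subset by blast
  then have "g ((1 - t) *\<^sub>R x + t *\<^sub>R y) = 0" by (rule zero)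
  moreover have "g ((1 - t) *\<^sub>R x + t *\<^sub>R y) = (1 - t) * g x + t * g y"
    using affine_fun_onD[OF aff _ y, of x "1 - t" t] xP assms(3) t by auto
  ultimately show ?thesis using zero[OF xP] t by simp
qed

section \<open>The bent arrangement and the full-dimensional cells\<close>

theorem theorem2:
  fixes N :: "'k::finite relu_network" and m :: nat and n :: "nat \<Rightarrow> nat"
  assumes "has_architecture N m n"
    and "transversal_network N"
  shows "bent_arrangement N = \<Union> (skeleton (int (n 0) - 1) (canonical_complex N)) \<and>
         closure ` activation_regions N = {C \<in> canonical_complex N. aff_dim C = int (n 0)}"
proof -
  let ?V = "layer_space N 0"
  let ?C = "canonical_complex N"
  let ?Q = "point_cell N m"
  let ?O = "\<lambda>x. open_cell ?V (nodes N m) (node N) (\<lambda>p. sgn (node N p x))"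
  note arch = assms(1)
  have hid: "hidden_layers N = m" using arch by (simp add: has_architecture_def)
  have dimV: "aff_dim ?V = int (n 0)"
    using arch unfolding aff_dim_layer_space has_architecture_def by simp
  have affV: "affine ?V" by (rule subspace_imp_affine[OF subspace_layer_space])
  have QV: "?Q x \<subseteq> ?V" for x by (auto simp: closed_cell_def)
  have cvx: "convex (?Q x)" for x by (rule convex_network_cell[OF arch order_refl])
  have clo: "closed (?Q x)" for x by (rule closed_network_cell)
  have aff: "affine_fun_on (?Q x) (node N p)" if "p \<in> nodes N m" for x p
    using that affine_node_network_cell[OF arch order_refl] by auto
  have cells: "?C - {{}} = {?Q x | x. x \<in> ?V}"
    using nonempty_cells_canonical_complex[OF arch order_refl] hid
    by (simp add: canonical_complex_def)
  \<comment> \<open>Transversality enters only here. The cell belongs to the complex of the first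
    \<open>i - 1\<close> layers, the canonical complex of the node map in layer
    \<open>i\<close>.\<close>
  have nonvanishing: "\<exists>y\<in>point_cell N (i - 1) x. node_map N i j y \<noteq> 0"
    if ij: "(i, j) \<in> nodes N m" and x: "x \<in> ?V" for i j x
  proof (rule transversal_threshold_not_vanishing)
    show "transversal_threshold (node_map N i j) (canonical_complex_upto N (i - 1)) 0"
      using assms(2) ij hid by (auto simp: transversal_network_def)
    have i: "i - 1 \<le> m" using ij by auto
    show "point_cell N (i - 1) x \<in> canonical_complex_upto N (i - 1)"
      using nonempty_cells_canonical_complex[OF arch i] x by blast
    show "convex (point_cell N (i - 1) x)" by (rule convex_network_cell[OF arch i])
    show "point_cell N (i - 1) x \<noteq> {}" using closed_cell_self[OF x] by blast
  qed
  have bent: "bent_arrangement N = {x \<in> ?V. \<exists>p\<in>nodes N m. node N p x = 0}"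
  proof -
    \<comment> \<open>A zero row makes the node map constant; one zero would make it vanish on a
      whole cell. So dropping degenerate rows from the arrangements loses no zeros.\<close>
    have "weight N i $ j \<noteq> 0" if ij: "(i, j) \<in> nodes N m" and x: "x \<in> ?V" "node_map N i j x = 0" for i j x
    proof
      assume "weight N i $ j = 0"
      then have "node_map N i j y = node_map N i j x" for y
        by (simp add: node_map_def affine_layer_nth)
      with nonvanishing[OF ij x(1)] x(2) show False by simp
    qed
    moreover have "hidden_map N (i - 1) x \<in> layer_space N (i - 1)" if "x \<in> ?V" "i \<in> {1..m}" for i x
      using hidden_map_in_layer_space[OF arch that(1), of "i - 1"] that(2) by auto
    moreover have "x \<in> bent_arrangement N \<longleftrightarrow> (\<exists>i\<in>{1..m}. \<exists>j\<in>units N i. weight N i $ j \<noteq> 0 \<and>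
        x \<in> ?V \<and> hidden_map N (i - 1) x \<in> layer_space N (i - 1) \<and> node_map N i j x = 0)" for x
      unfolding bent_arrangement_def bent_layer_def layer_arrangement_def hid node_map_def affine_layer_nth
      by blast
    moreover have "(\<exists>p\<in>nodes N m. node N p x = 0) \<longleftrightarrow>
        (\<exists>i\<in>{1..m}. \<exists>j\<in>units N i. node_map N i j x = 0)" for x
      by force
    ultimately have "x \<in> bent_arrangement N \<longleftrightarrow> x \<in> ?V \<and> (\<exists>p\<in>nodes N m. node N p x = 0)" for x
      by (metis (no_types, lifting) mem_Sigma_iff)
    then show ?thesis by blast
  qed
  \<comment> \<open>The link between both claims: cells of points on the bent arrangement are
    lower-dimensional, all others are full-dimensional.\<close>
  have full: "aff_dim (?Q x) = int (n 0) \<longleftrightarrow> x \<notin> bent_arrangement N" if x: "x \<in> ?V" for x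
  proof
    assume dim: "aff_dim (?Q x) = int (n 0)"
    have hull: "affine hull ?Q x = ?V"
      using aff_dim_psubset[of "?Q x" ?V] hull_mono[OF QV, of affine x] dim dimV affV
      by (auto simp: affine_hull_eq[THEN iffD2])
    show "x \<notin> bent_arrangement N"
    proof
      assume "x \<in> bent_arrangement N"
      then obtain i j where ij: "(i, j) \<in> nodes N m" and 0: "node_map N i j x = 0"
        unfolding bent by auto
      \<comment> \<open>From here to the end of this subproof \<open>?C\<close> is the cell of the
        preceding complex around \<open>?Q x\<close>. If \<open>?Q x\<close> spans the input space,
        a node map vanishing on \<open>?Q x\<close> vanishes on all of \<open>?C\<close>.\<close>
      let ?C = "point_cell N (i - 1) x"
      have im: "i - 1 \<le> m" "1 \<le> i" using ij by auto
      have sub: "?Q x \<subseteq> ?C" by (rule network_cell_antimono[OF im(1)])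
      have CV: "?C \<subseteq> ?V" by (auto simp: closed_cell_def)
      have affC: "affine_fun_on ?C (node_map N i j)"
        by (rule affine_node_network_cell[OF arch im]) simp
      have "node_map N i j y = 0" if "y \<in> ?C" for y
      proof (rule affine_fun_zero_on_full_subset[OF cvx _ sub _ affC _ that])
        show "?Q x \<noteq> {}" using closed_cell_self[OF x] by blast
        show "?C \<subseteq> affine hull ?Q x" using CV hull by simp
        show "node_map N i j z = 0" if "z \<in> ?Q x" for z
          using that ij 0 by (fastforce simp: closed_cell_def sgn_0_0)
      qed
      with nonvanishing[OF ij x] show False by blast
    qed
  next
    assume "x \<notin> bent_arrangement N"
    then have nz: "\<forall>p\<in>nodes N m. node N p x \<noteq> 0" using x unfolding bent by blast
    \<comment> \<open>Multiplying by the sign at \<open>x\<close> turns the strict sign conditions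
      into finitely many open inequalities, so \<open>?O x\<close> is relatively open and nonempty
      in \<open>?V\<close>.\<close>
    let ?U = "\<Inter>p\<in>nodes N m. {y. 0 < sgn (node N p x) * node N p y}"
    have "open ?U"
      by (intro open_INT nodes_finite ballI open_Collect_less continuous_intros continuous_node)
    moreover have eq: "?O x = ?V \<inter> ?U"
      using nz by (force simp: open_cell_def sgn_if split: if_splits)
    ultimately have "openin (top_of_set ?V) (?O x)" by (auto simp: openin_open)
    moreover have "?O x \<noteq> {}" using x by (auto simp: open_cell_def)
    ultimately have "aff_dim (?O x) = aff_dim ?V" by (intro aff_dim_openin affV)
    moreover have "aff_dim (?O x) \<le> aff_dim (?Q x)"
      by (rule aff_dim_subset[OF open_cell_subset_closed_cell])
    moreover have "aff_dim (?Q x) \<le> aff_dim ?V" by (rule aff_dim_subset[OF QV])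
    ultimately show "aff_dim (?Q x) = int (n 0)" using dimV by simp
  qed
  have "bent_arrangement N = \<Union> (skeleton (int (n 0) - 1) ?C)"
  proof (intro equalityI subsetI)
    fix x assume x: "x \<in> bent_arrangement N"
    then have xV: "x \<in> ?V" unfolding bent by blast
    then have "?Q x \<in> ?C" using cells by blast
    moreover have "aff_dim (?Q x) \<le> int (n 0) - 1"
      using full[OF xV] x aff_dim_subset[OF QV, of x] dimV by linarith
    moreover have "x \<in> ?Q x" by (rule closed_cell_self[OF xV])
    ultimately show "x \<in> \<Union> (skeleton (int (n 0) - 1) ?C)"
      unfolding skeleton_def by blast
  next
    fix y assume "y \<in> \<Union> (skeleton (int (n 0) - 1) ?C)"
    then obtain T where T: "T \<in> ?C" "aff_dim T \<le> int (n 0) - 1" "y \<in> T"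
      unfolding skeleton_def by blast
    then obtain x where x: "x \<in> ?V" "T = ?Q x" using cells by blast
    with T full[OF x(1)] have "x \<in> bent_arrangement N" by auto
    then obtain p where p: "p \<in> nodes N m" "node N p x = 0" unfolding bent by blast
    \<comment> \<open>Sign 0 at \<open>x\<close> is the condition \<open>node N p = 0\<close> on the
      whole cell of \<open>x\<close>.\<close>
    have "node N p y = 0" using T(3) p unfolding x(2) closed_cell_def by (force simp: sgn_0_0)
    with p T(3) x QV show "y \<in> bent_arrangement N" unfolding bent by blast
  qed
  moreover have "closure ` activation_regions N = {C \<in> ?C. aff_dim C = int (n 0)}"
  proof -
    have U: "?V - bent_arrangement N = {x \<in> ?V. \<forall>p\<in>nodes N m. node N p x \<noteq> 0}"
      unfolding bent by blast
    have "activation_regions N = {?O x | x. x \<in> ?V \<and> (\<forall>p\<in>nodes N m. node N p x \<noteq> 0)}"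
      unfolding activation_regions_def U
    proof (rule components_sign)
      show "continuous_on ?V (node N p)" for p
        using continuous_node continuous_on_subset by blast
      show "connected (?O x)" if "x \<in> ?V" "\<forall>p\<in>nodes N m. node N p x \<noteq> 0" for x
        using that by (intro convex_connected convex_open_cell cvx aff) (auto simp: sgn_0_0)
    qed
    also have "\<dots> = {?O x | x. x \<in> ?V - bent_arrangement N}" unfolding bent by blast
    finally have regions: "activation_regions N = ?O ` (?V - bent_arrangement N)" by blast
    have "closure (?O x) = ?Q x" if x: "x \<in> ?V - bent_arrangement N" for x
    proof (rule closure_open_cell[OF cvx aff _ clo])
      show "sgn (node N p x) \<noteq> 0" if "p \<in> nodes N m" for p
        using x that unfolding bent by (auto simp: sgn_0_0)
      show "x \<in> ?O x" using x by (auto simp: open_cell_def)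
    qed
    then have "closure ` activation_regions N = ?Q ` (?V - bent_arrangement N)"
      unfolding regions image_image by (rule image_cong[OF refl])
    also have "\<dots> = {C \<in> ?C - {{}}. aff_dim C = int (n 0)}"
      unfolding cells using full by blast
    \<comment> \<open>The empty cell has dimension -1 and thus never dimension
      \<open>n 0\<close>.\<close>
    also have "\<dots> = {C \<in> ?C. aff_dim C = int (n 0)}" by auto
    finally show ?thesis .
  qed
  ultimately show ?thesis by blast
qed

end
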